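(* For every positive integer $d$ and every $\epsilon>0$ there exists a positive integer $K=K(\epsilon,d)\ge d+1$ such that for every integer $k\ge K$ the following holds. For every point $q\in\mathbb{R}^d$ and every finite Borel measure $\mu$ on $\mathbb{R}^d$ with respect to which every hyperplane has measure $0$, there is a partition $\mathbb{R}^d=A_1\cup\cdots\cup A_k$ into $k$ measurable parts of equal $\mu$-measure such that all but at most an $\epsilon$-fraction of the $(d+1)$-tuples $A_{i_1},\ldots,A_{i_{d+1}}$ (with $1\le i_1<\cdots<i_{d+1}\le k$) are homogeneous with respect to $q$.
   Context: A $(d+1)$-tuple of subsets $S_1,\ldots,S_{d+1}\subseteq\mathbb{R}^d$ is homogeneous with respect to a point $q$ if either every closed simplex $\mathrm{conv}\{s_1,\ldots,s_{d+1}\}$ with $s_j\in S_j$ for all $j$ contains $q$, or none of these simplices contains $q$. *)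

theory Defs
  imports "HOL-Analysis.Analysis"
begin

text \<open>The sets \<open>S j\<close> with \<open>j \<in> J\<close> form the tuple; over \<open>real ^ 'n\<close> it is used with
  \<open>card J = CARD('n) + 1\<close>. Neither alternative depends on an ordering of \<open>J\<close>. The simplices
  may be degenerate.\<close>

definition homogeneous_wrt :: "'a::real_vector \<Rightarrow> 'i set \<Rightarrow> ('i \<Rightarrow> 'a set) \<Rightarrow> bool" where
  "homogeneous_wrt q J S \<longleftrightarrow>
     (\<forall>s. (\<forall>j\<in>J. s j \<in> S j) \<longrightarrow> q \<in> convex hull (s ` J)) \<or>
     (\<forall>s. (\<forall>j\<in>J. s j \<in> S j) \<longrightarrow> q \<notin> convex hull (s ` J))"

text \<open>Increasing tuples \<open>i\<^sub>1 < \<dots> < i\<^sub>m\<close> in \<open>{1..k}\<close> are represented by their sets of entries.\<close>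

definition index_tuples :: "nat \<Rightarrow> nat \<Rightarrow> nat set set" where
  "index_tuples k m = {I. I \<subseteq> {1..k} \<and> card I = m}"

end

theory Submission
  imports Defs "HOL-Probability.Distribution_Functions"
begin

text \<open>
  A tuple \<open>S\<^sub>0, \<dots>, S\<^sub>d\<close> is homogeneous with respect to \<open>q\<close> as soon as any \<open>d\<close> of the sets lie in a common
  open half-space with \<open>q\<close> on its boundary. Given \<open>d\<close> sets, a hyperplane through \<open>q\<close> and centerpoints
  (obtained from Helly's theorem) of \<open>d - 1\<close> of them leaves a fixed fraction of all \<open>d\<close> sets on one
  of its sides. Applying this to each choice of \<open>d\<close> sets shows that every tuple of \<open>d + 1\<close>
  measurable sets contains a homogeneous tuple of subsets of proportionally large measure.

  Refining a finite partition by such subsets, for all tuples of cells at once, multiplies the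
  total weight (product of measures) of the non-homogeneous tuples by a factor bounded away
  from 1, while the number of cells remains bounded independently of the measure. After boundedly many
  rounds the weight is below any prescribed fraction. Finally the cells are cut into parts of
  measure \<open>\<mu>(UNIV) / k\<close>; all but boundedly many parts lie inside one cell, and the
  tuples involving the exceptional parts are negligible for large \<open>k\<close>.
\<close>

section \<open>Half-spaces and homogeneity\<close>

text \<open>Dividing by the sum of the coefficients turns a nontrivial nonnegative relation into a
  convex combination. The indexed form lets \<open>s\<close> repeat points, and the unnormalized
  relation can be added to a linear dependence.\<close>

lemma in_convex_hull_image_iff:
  fixes q :: "'a::real_vector"
  assumes "finite I"
  shows "q \<in> convex hull (s ` I) \<longleftrightarrow>
    (\<exists>c. (\<forall>i\<in>I. 0 \<le> c i) \<and> (\<exists>i\<in>I. c i \<noteq> 0) \<and> (\<Sum>i\<in>I. c i *\<^sub>R (s i - q)) = 0)"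
    (is "_ \<longleftrightarrow> (\<exists>c. ?P c)")
proof
  \<comment> \<open>The indexed convex combinations form a convex set containing every
    \<open>s i\<close>, hence the hull.\<close>
  define T where "T = {\<Sum>i\<in>I. c i *\<^sub>R s i | c. (\<forall>i\<in>I. 0 \<le> c i) \<and> sum c I = (1::real)}"
  have "convex T"
  proof (rule convexI)
    fix x y and u v :: real
    assume "x \<in> T" "y \<in> T" and uv: "0 \<le> u" "0 \<le> v" "u + v = 1"
    then obtain c e where c: "\<forall>i\<in>I. 0 \<le> c i" "sum c I = 1" "x = (\<Sum>i\<in>I. c i *\<^sub>R s i)"
      and e: "\<forall>i\<in>I. 0 \<le> e i" "sum e I = 1" "y = (\<Sum>i\<in>I. e i *\<^sub>R s i)"
      by (auto simp: T_def)
    have "u *\<^sub>R x + v *\<^sub>R y = (\<Sum>i\<in>I. (u * c i + v * e i) *\<^sub>R s i)"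
      by (simp add: c e scaleR_sum_right sum.distrib scaleR_add_left)
    moreover have "(\<Sum>i\<in>I. u * c i + v * e i) = 1"
      using c e uv by (simp add: sum.distrib flip: sum_distrib_left)
    ultimately show "u *\<^sub>R x + v *\<^sub>R y \<in> T"
      using c e uv unfolding T_def by (auto intro!: exI[of _ "\<lambda>i. u * c i + v * e i"])
  qed
  moreover have "s ` I \<subseteq> T"
  proof
    fix x assume "x \<in> s ` I"
    then obtain j where j: "j \<in> I" "x = s j" by auto
    then show "x \<in> T"
      using assms unfolding T_def
      by (auto intro!: exI[of _ "\<lambda>i. if i = j then 1 else 0"] simp: if_distrib[of "\<lambda>c. c *\<^sub>R _"] cong: if_cong)
  qed
  ultimately have "convex hull (s ` I) \<subseteq> T" by (simp add: hull_minimal)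
  moreover assume "q \<in> convex hull (s ` I)"
  ultimately obtain c where c: "\<forall>i\<in>I. 0 \<le> c i" "sum c I = 1" "q = (\<Sum>i\<in>I. c i *\<^sub>R s i)"
    by (auto simp: T_def)
  then have "(\<Sum>i\<in>I. c i *\<^sub>R (s i - q)) = 0"
    by (simp add: scaleR_diff_right sum_subtractf flip: scaleR_sum_left)
  moreover have "\<exists>i\<in>I. c i \<noteq> 0" using c(2) by (metis sum.neutral zero_neq_one)
  ultimately show "\<exists>c. ?P c" using c by blast
next
  assume "\<exists>c. ?P c"
  then obtain c where c: "\<forall>i\<in>I. 0 \<le> c i" "\<exists>i\<in>I. c i \<noteq> 0" "(\<Sum>i\<in>I. c i *\<^sub>R (s i - q)) = 0"
    by blast
  define L where "L = sum c I"
  have "0 < L" using c assms unfolding L_def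
    by (metis sum_pos2 order_le_less)
  have "(\<Sum>i\<in>I. c i *\<^sub>R s i) = L *\<^sub>R q"
    using c(3) by (simp add: scaleR_diff_right sum_subtractf L_def flip: scaleR_sum_left)
  then have "(\<Sum>i\<in>I. (c i / L) *\<^sub>R s i) = q"
    using \<open>0 < L\<close> scaleR_sum_right[of "1 / L" "\<lambda>i. c i *\<^sub>R s i" I] by simp
  moreover have "(\<Sum>i\<in>I. (c i / L) *\<^sub>R s i) \<in> convex hull (s ` I)"
    using assms c \<open>0 < L\<close>
    by (intro convex_sum) (auto simp: L_def hull_inc simp flip: sum_divide_distrib)
  ultimately show "q \<in> convex hull (s ` I)" by simp
qed

text \<open>Indices are counted, not vectors: if \<open>v\<close> repeats a value, the difference of
  the two unit coefficients is already a dependence.\<close>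

lemma indexed_linear_dependence:
  fixes v :: "'i \<Rightarrow> 'a::euclidean_space"
  assumes "finite I" "DIM('a) < card I"
  shows "\<exists>b. (\<exists>i\<in>I. b i \<noteq> 0) \<and> (\<Sum>i\<in>I. b i *\<^sub>R v i) = 0"
proof (cases "inj_on v I")
  case True
  then have "dependent (v ` I)"
    using assms by (intro dependent_biggerset) (simp add: card_image)
  then obtain u where "\<exists>x\<in>v ` I. u x \<noteq> 0" "(\<Sum>x\<in>v ` I. u x *\<^sub>R x) = 0"
    using assms by (auto simp: dependent_finite)
  then show ?thesis
    using True by (intro exI[of _ "\<lambda>i. u (v i)"]) (auto simp: sum.reindex)
next
  case False
  then obtain i j where ij: "i \<in> I" "j \<in> I" "i \<noteq> j" "v i = v j" by (auto simp: inj_on_def)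
  define b :: "'i \<Rightarrow> real" where "b l = (if l = i then 1 else 0) - (if l = j then 1 else 0)" for l
  have "(\<Sum>l\<in>I. b l *\<^sub>R v l) = v i - v j"
    using ij assms
    by (simp add: b_def scaleR_diff_left sum_subtractf if_distrib[of "\<lambda>c. c *\<^sub>R _"] cong: if_cong)
  then show ?thesis using ij by (intro exI[of _ b]) (auto simp: b_def)
qed

text \<open>If \<open>q\<close> is lost when \<open>s i\<close> is replaced by \<open>t i\<close>, then adding a suitable multiple of the convex
  combination representing \<open>q\<close> to a linear dependence of the new vectors makes one coefficient,
  of index \<open>l\<close>, vanish and all others nonnegative; the half-space omitting index \<open>l\<close> excludes this.\<close>

lemma convex_hull_swap_vertex:
  fixes s t :: "'i \<Rightarrow> 'a::euclidean_space"
  assumes I: "finite I" "card I = DIM('a) + 1" "i \<in> I"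
    and eq: "\<And>j. j \<in> I - {i} \<Longrightarrow> s j = t j"
    and sep: "\<And>l. l \<in> I \<Longrightarrow> \<exists>a. \<forall>j\<in>I - {l}. 0 < a \<bullet> (s j - q) \<and> 0 < a \<bullet> (t j - q)"
    and q: "q \<in> convex hull (s ` I)"
  shows "q \<in> convex hull (t ` I)"
proof (rule ccontr)
  assume neg: "q \<notin> convex hull (t ` I)"
  obtain c where c: "\<forall>j\<in>I. 0 \<le> c j" "\<exists>j\<in>I. c j \<noteq> 0" "(\<Sum>j\<in>I. c j *\<^sub>R (s j - q)) = 0"
    using q in_convex_hull_image_iff[OF I(1)] by metis
  \<comment> \<open>Pair the relation with the normal of the half-space omitting \<open>l\<close>:
    all terms are nonnegative, so all are zero. The extra term at \<open>t i\<close> must disappear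
    when \<open>l = i\<close>, as that half-space says nothing about \<open>t i\<close>.\<close>
  have vanish: "g j = 0"
    if l: "l \<in> I" and g: "\<And>j. j \<in> I \<Longrightarrow> 0 \<le> g j" "g l = 0" and d: "0 \<le> d" "l = i \<Longrightarrow> d = 0"
      and sum0: "(\<Sum>j\<in>I. g j *\<^sub>R (s j - q)) + d *\<^sub>R (t i - q) = 0" and j: "j \<in> I" for g l d j
  proof -
    obtain a where a: "\<And>j. j \<in> I - {l} \<Longrightarrow> 0 < a \<bullet> (s j - q) \<and> 0 < a \<bullet> (t j - q)"
      using sep[OF l] by auto
    have nonneg: "0 \<le> g j * (a \<bullet> (s j - q))" if "j \<in> I" for j
      using a[of j] g that by (cases "j = l") auto
    have "0 \<le> d * (a \<bullet> (t i - q))"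
      using a[of i] d I(3) by (cases "l = i") auto
    moreover have "(\<Sum>j\<in>I. g j * (a \<bullet> (s j - q))) + d * (a \<bullet> (t i - q)) = 0"
      using arg_cong[OF sum0, of "\<lambda>x. a \<bullet> x"] by (simp add: inner_add_right inner_sum_right)
    moreover have "0 \<le> (\<Sum>j\<in>I. g j * (a \<bullet> (s j - q)))" using nonneg by (simp add: sum_nonneg)
    ultimately have "(\<Sum>j\<in>I. g j * (a \<bullet> (s j - q))) = 0" by linarith
    then have "g j * (a \<bullet> (s j - q)) = 0"
      using nonneg j I(1) by (simp add: sum_nonneg_eq_0_iff)
    then show ?thesis using a[of j] g(2) j by (cases "j = l") auto
  qed
  \<comment> \<open>A zero coefficient would let \<open>vanish\<close> apply with
    \<open>d = 0\<close> and annihilate all of \<open>c\<close>.\<close>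
  have c_pos: "0 < c j" if "j \<in> I" for j
    using vanish[of j c 0] c that by (metis add.right_neutral order_le_less scaleR_zero_left)
  obtain b0 where b0: "\<exists>j\<in>I. b0 j \<noteq> 0" "(\<Sum>j\<in>I. b0 j *\<^sub>R (t j - q)) = 0"
    using indexed_linear_dependence[OF I(1), of "\<lambda>j. t j - q"] I(2) by auto
  \<comment> \<open>The sign is chosen so that the coefficient at \<open>i\<close> is nonnegative
    and, if it is zero, some other coefficient is negative.\<close>
  define b where "b = (if b0 i > 0 \<or> b0 i = 0 \<and> (\<exists>j\<in>I. b0 j < 0) then b0 else (\<lambda>j. - b0 j))"
  have b: "(\<Sum>j\<in>I. b j *\<^sub>R (t j - q)) = 0" "0 \<le> b i" "0 < b i \<or> (\<exists>j\<in>I. b j < 0)"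
    subgoal using b0(2) by (simp add: b_def sum_negf)
    subgoal by (auto simp: b_def)
    subgoal using b0(1) unfolding b_def by (smt (verit))
    done
  then have "\<exists>j\<in>I. b j \<noteq> 0" using I(3) by force
  then have "\<exists>j\<in>I. b j < 0"
    using neg b(1) unfolding in_convex_hull_image_iff[OF I(1)] by (meson not_le)
  then obtain k where k: "k \<in> I - {i}" "b k < 0" using b(2) by force
  \<comment> \<open>The least multiple of \<open>c\<close> that makes
    \<open>b j + \<tau> * c j\<close> nonnegative for all indices other than \<open>i\<close>; at an
    index \<open>l\<close> attaining the maximum this coefficient is zero.\<close>
  define \<tau> where "\<tau> = Max ((\<lambda>j. - b j / c j) ` (I - {i}))"
  have "\<tau> \<in> (\<lambda>j. - b j / c j) ` (I - {i})"
    unfolding \<tau>_def using I(1) k by (intro Max_in) auto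
  then obtain l where l: "l \<in> I - {i}" "\<tau> = - b l / c l" by auto
  have le: "- b j / c j \<le> \<tau>" if "j \<in> I - {i}" for j
    unfolding \<tau>_def using I(1) that by (intro Max_ge) auto
  have "0 < \<tau>"
    using le[OF k(1)] k c_pos[of k] by (smt (verit) DiffD1 divide_pos_pos)
  \<comment> \<open>Coefficients of \<open>b\<close> plus \<open>\<tau>\<close> times
    \<open>c\<close>, except that \<open>b i\<close> stays with \<open>t i\<close> and enters
    \<open>vanish\<close> as \<open>d\<close>.\<close>
  define g where "g j = (if j = i then \<tau> * c i else b j + \<tau> * c j)" for j
  have "g i = 0"
  proof (rule vanish[of l g "b i" i])
    show "l \<in> I" "i \<in> I" "0 \<le> b i" "l = i \<Longrightarrow> b i = 0" using l I b by auto
    show "g l = 0" using l c_pos[of l] by (auto simp: g_def)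
    show "0 \<le> g j" if "j \<in> I" for j
      using le[of j] c_pos[OF that] \<open>0 < \<tau>\<close> that by (auto simp: g_def field_simps)
    have "(\<Sum>j\<in>I. g j *\<^sub>R (s j - q)) + b i *\<^sub>R (t i - q)
        = \<tau> *\<^sub>R c i *\<^sub>R (s i - q) + (\<Sum>j\<in>I - {i}. (b j + \<tau> * c j) *\<^sub>R (s j - q)) + b i *\<^sub>R (t i - q)"
      using I by (simp add: sum.remove[of I i] g_def)
    also have "\<dots> = \<tau> *\<^sub>R (c i *\<^sub>R (s i - q) + (\<Sum>j\<in>I - {i}. c j *\<^sub>R (s j - q)))
        + (b i *\<^sub>R (t i - q) + (\<Sum>j\<in>I - {i}. b j *\<^sub>R (t j - q)))"
      using eq by (simp add: scaleR_add_left scaleR_add_right sum.distrib scaleR_sum_right)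
    also have "\<dots> = 0"
      using c(3) b(1) I sum.remove[of I i "\<lambda>j. c j *\<^sub>R (s j - q)"]
        sum.remove[of I i "\<lambda>j. b j *\<^sub>R (t j - q)"] by simp
    finally show "(\<Sum>j\<in>I. g j *\<^sub>R (s j - q)) + b i *\<^sub>R (t i - q) = 0" .
  qed
  then show False using \<open>0 < \<tau>\<close> c_pos[OF I(3)] by (simp add: g_def)
qed

text \<open>Pass from one choice of points to another by exchanging one vertex at a time; the
  half-spaces apply to every intermediate choice, so \<open>q\<close> stays in the hull
  throughout.\<close>

lemma homogeneous_wrt_if_halfspaces:
  fixes S :: "'i \<Rightarrow> 'a::euclidean_space set"
  assumes I: "finite I" "card I = DIM('a) + 1"
    and sep: "\<And>i. i \<in> I \<Longrightarrow> \<exists>a. \<forall>j\<in>I - {i}. \<forall>x\<in>S j. 0 < a \<bullet> (x - q)"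
  shows "homogeneous_wrt q I S"
proof -
  have "q \<in> convex hull (t ` I)"
    if s: "\<forall>j\<in>I. s j \<in> S j" "q \<in> convex hull (s ` I)" and t: "\<forall>j\<in>I. t j \<in> S j" for s t
  proof -
    define u where "u F j = (if j \<in> F then t j else s j)" for F j
    have "q \<in> convex hull (u F ` I)" if "F \<subseteq> I" for F
      using finite_subset[OF that I(1)] that
    proof (induction F)
      case empty
      then show ?case using s by (simp add: u_def)
    next
      case (insert i F)
      show ?case
      proof (rule convex_hull_swap_vertex[of I i "u F"])
        show "\<exists>a. \<forall>j\<in>I - {l}. 0 < a \<bullet> (u F j - q) \<and> 0 < a \<bullet> (u (insert i F) j - q)"
          if "l \<in> I" for l
          using sep[OF that] s(1) t by (fastforce simp: u_def)
      qed (use insert I in \<open>auto simp: u_def\<close>)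
    qed
    from this[of I] show ?thesis by (simp add: u_def cong: image_cong)
  qed
  then show ?thesis unfolding homogeneous_wrt_def by blast
qed

lemma homogeneous_wrt_mono:
  assumes "homogeneous_wrt q J S" "\<And>j. j \<in> J \<Longrightarrow> S' j \<subseteq> S j"
  shows "homogeneous_wrt q J S'"
  using assms unfolding homogeneous_wrt_def by (meson subsetD)

lemma homogeneous_wrt_reindex:
  fixes S :: "'i \<Rightarrow> 'a::real_vector set"
  assumes "homogeneous_wrt q J (\<lambda>j. S (h j))" "bij_betw h J I"
  shows "homogeneous_wrt q I S"
proof -
  have "h ` J = I" using assms(2) by (simp add: bij_betw_def)
  then have "(\<lambda>j. s (h j)) ` J = s ` I" for s :: "'i \<Rightarrow> 'a" by (metis image_image)
  moreover have "(\<forall>j\<in>I. s j \<in> S j) \<longleftrightarrow> (\<forall>j\<in>J. s (h j) \<in> S (h j))" for s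
    using \<open>h ` J = I\<close> by blast
  ultimately show ?thesis using assms(1) unfolding homogeneous_wrt_def by metis
qed

section \<open>Centerpoints and homogeneous subsets of positive fraction\<close>

locale borel_finite_measure = finite_measure M for M :: "'a::euclidean_space measure" +
  assumes sets_eq_borel: "sets M = sets borel"
begin

lemma sets_M: "A \<in> sets borel \<Longrightarrow> A \<in> sets M"
  by (simp add: sets_eq_borel)

lemma space_M: "space M = UNIV"
  using sets_eq_imp_space_eq[OF sets_eq_borel] by simp

text \<open>If the intersection were empty, the complements would cover \<open>Y\<close> with total
  measure too small. This supplies the hypothesis of Helly's theorem.\<close>

lemma large_sets_intersect:
  assumes "finite G" "real (card G) * e \<le> measure M Y" "Y \<in> sets M" "0 < measure M Y"
    and "\<And>S. S \<in> G \<Longrightarrow> S \<in> sets M \<and> measure M (Y - S) < e"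
  shows "\<Inter>G \<noteq> {}"
proof
  assume empty: "\<Inter>G = {}"
  then have "G \<noteq> {}" by auto
  have "measure M Y \<le> measure M (\<Union>S\<in>G. Y - S)"
    using empty assms by (intro finite_measure_mono) auto
  also have "\<dots> \<le> (\<Sum>S\<in>G. measure M (Y - S))"
    using assms by (intro measure_UNION_le) auto
  also have "\<dots> < (\<Sum>S\<in>G. e)"
    using assms \<open>G \<noteq> {}\<close> by (intro sum_strict_mono) auto
  finally show False using assms by simp
qed

text \<open>A point common to all closed half-spaces missing less than \<open>c\<close> of
  \<open>Y\<close> is a centerpoint. Helly's theorem handles finitely many of them, compactness of a
  ball handles all. The factor 2 pays for the part of \<open>Y\<close> outside the ball.\<close>

lemma exists_centerpoint:
  assumes Y: "Y \<in> sets M" "0 < measure M Y"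
  shows "\<exists>p. \<forall>a. measure M Y / (2 * (DIM('a) + 1)) \<le> measure M (Y \<inter> {x. a \<bullet> p \<le> a \<bullet> x})"
proof -
  define c where "c = measure M Y / (2 * (DIM('a) + 1))"
  have c: "0 < c" "(DIM('a) + 1) * (2 * c) = measure M Y"
    using Y by (auto simp: c_def field_simps)
  have "(\<lambda>n. measure M (Y \<inter> cball 0 (real n))) \<longlonglongrightarrow> measure M (\<Union>n. Y \<inter> cball 0 (real n))"
    using Y by (intro finite_Lim_measure_incseq) (auto simp: incseq_def sets_eq_borel)
  moreover have "(\<Union>n. Y \<inter> cball 0 (real n)) = Y"
    by (auto simp: real_arch_simple)
  ultimately have "eventually (\<lambda>n. measure M Y - c < measure M (Y \<inter> cball 0 (real n))) sequentially"
    using c by (intro order_tendstoD(1)) auto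
  then obtain n where n: "measure M Y - c < measure M (Y \<inter> cball 0 (real n))"
    by (auto simp: eventually_sequentially)
  define B where "B = cball (0::'a) (real n)"
  have B: "B \<in> sets M" "measure M (Y - B) < c"
    using n Y finite_measure_Diff'[of Y B] by (auto simp: B_def sets_eq_borel)
  define F where "F = {{x. a \<bullet> x \<le> b} | a b. measure M (Y - {x. a \<bullet> x \<le> b}) < c}"
  have F: "closed H" "convex H" "H \<in> sets M" "measure M (Y - (B \<inter> H)) < 2 * c" if "H \<in> F" for H
  proof -
    show H: "closed H" "convex H"
      using that by (auto simp: F_def closed_halfspace_le convex_halfspace_le)
    then show "H \<in> sets M" by (auto intro: sets_M)
    then have "measure M (Y - (B \<inter> H)) \<le> measure M (Y - B) + measure M (Y - H)"
      unfolding Diff_Int using Y B by (intro measure_Un_le) auto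
    also have "\<dots> < 2 * c" using B that by (auto simp: F_def)
    finally show "measure M (Y - (B \<inter> H)) < 2 * c" .
  qed
  have "B \<inter> \<Inter>F \<noteq> {}"
  proof (rule compact_imp_fip)
    fix F' assume F': "finite F'" "F' \<subseteq> F"
    \<comment> \<open>Including \<open>B\<close> keeps the intersection inside the ball even when
      \<open>F'\<close> is empty.\<close>
    define G where "G = insert B ((\<inter>) B ` F')"
    have G: "convex S" "S \<in> sets M" "measure M (Y - S) < 2 * c" if "S \<in> G" for S
    proof -
      consider "S = B" | H where "H \<in> F" "S = B \<inter> H" using \<open>S \<in> G\<close> F' by (auto simp: G_def)
      then have "convex S \<and> S \<in> sets M \<and> measure M (Y - S) < 2 * c"
      proof cases
        case 1
        then show ?thesis using B c(1) by (simp add: B_def)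
      next
        case 2
        have "convex B" by (simp add: B_def)
        then have "convex (B \<inter> H)" using F(2)[OF 2(1)] by (rule convex_Int)
        moreover have "B \<inter> H \<in> sets M" using B(1) F(3)[OF 2(1)] by (rule sets.Int)
        ultimately show ?thesis using F(4)[OF 2(1)] unfolding 2(2) by blast
      qed
      then show "convex S" "S \<in> sets M" "measure M (Y - S) < 2 * c" by auto
    qed
    have small: "\<Inter>T \<noteq> {}" if "T \<subseteq> G" "card T \<le> DIM('a) + 1" for T
    proof (rule large_sets_intersect[of T "2 * c" Y])
      show "finite T" using that F' by (auto simp: G_def intro: finite_subset)
      have "real (card T) * (2 * c) \<le> (DIM('a) + 1) * (2 * c)"
        using that c by (intro mult_right_mono) auto
      then show "real (card T) * (2 * c) \<le> measure M Y" using c(2) by linarith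
    qed (use that G Y in auto)
    have "\<Inter>G \<noteq> {}"
    proof (cases "card G \<le> DIM('a) + 1")
      case False
      show ?thesis
      proof (rule Helly)
        show "\<forall>S\<in>G. convex S" using G(1) by blast
        show "\<Inter>T \<noteq> {}" if "T \<subseteq> G" "card T = DIM('a) + 1" for T
          using small that by simp
      qed (use False in simp)
    qed (rule small, simp_all)
    then show "B \<inter> \<Inter>F' \<noteq> {}" by (auto simp: G_def split: if_splits)
  qed (auto simp: F B_def)
  then obtain p where p: "\<And>H. H \<in> F \<Longrightarrow> p \<in> H" by auto
  have "c \<le> measure M (Y \<inter> {x. a \<bullet> p \<le> a \<bullet> x})" for a
  proof (rule ccontr)
    assume "\<not> ?thesis"
    then have less: "measure M (Y \<inter> {x. a \<bullet> p \<le> a \<bullet> x}) < c" by simp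
    \<comment> \<open>Within \<open>Y\<close> these sets decrease to the closed half-space bounded
      at \<open>p\<close>. If that one were too light, so would be some \<open>S i\<close>, and the
      half-space removed in it would belong to \<open>F\<close> without containing
      \<open>p\<close>.\<close>
    define S where "S i = Y - {x. a \<bullet> x \<le> a \<bullet> p - inverse (real (Suc i))}" for i
    have "(\<lambda>i. measure M (S i)) \<longlonglongrightarrow> measure M (\<Inter>i. S i)"
    proof (rule finite_Lim_measure_decseq)
      show "range S \<subseteq> sets M" using Y by (auto simp: S_def sets_eq_borel)
      show "decseq S"
      proof (rule decseq_SucI)
        have "inverse (real (Suc (Suc i))) \<le> inverse (real (Suc i))" for i
          by (intro le_imp_inverse_le) auto
        then show "S (Suc i) \<subseteq> S i" for i
          unfolding S_def by (smt (verit) Diff_mono Collect_mono subset_refl)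
      qed
    qed
    moreover have "(\<Inter>i. S i) = Y \<inter> {x. a \<bullet> p \<le> a \<bullet> x}"
    proof -
      have "a \<bullet> p \<le> a \<bullet> x" if "\<And>i. \<not> a \<bullet> x \<le> a \<bullet> p - inverse (real (Suc i))" for x
        using that reals_Archimedean[of "a \<bullet> p - a \<bullet> x"] by (smt (verit))
      moreover have "\<not> a \<bullet> x \<le> a \<bullet> p - inverse (real (Suc i))" if "a \<bullet> p \<le> a \<bullet> x" for x i
        using that inverse_positive_iff_positive[of "real (Suc i)"] by linarith
      ultimately show ?thesis by (fastforce simp: S_def)
    qed
    ultimately have "eventually (\<lambda>i. measure M (S i) < c) sequentially"
      using less by (intro order_tendstoD(2)) auto
    then obtain i where "measure M (S i) < c" by (auto simp: eventually_sequentially)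
    then have "{x. a \<bullet> x \<le> a \<bullet> p - inverse (real (Suc i))} \<in> F"
      by (auto simp: F_def S_def)
    from p[OF this] show False by simp
  qed
  then show ?thesis unfolding c_def by blast
qed

end

section \<open>Common half-spaces and homogeneous subsets\<close>

locale hyperplane_null_measure = borel_finite_measure +
  assumes hyperplane_null: "a \<noteq> 0 \<Longrightarrow> emeasure M {x. a \<bullet> x = b} = 0"
begin

lemma halfspace_sets: "{x. b < a \<bullet> x} \<in> sets M" "{x. b \<le> a \<bullet> x} \<in> sets M"
  by (rule sets_M; simp)+

lemma measure_Int_open_halfspace:
  assumes "Y \<in> sets M" "a \<noteq> 0"
  shows "measure M (Y \<inter> {x. b < a \<bullet> x}) = measure M (Y \<inter> {x. b \<le> a \<bullet> x})"
proof -
  have "Y \<inter> {x. b \<le> a \<bullet> x} = (Y \<inter> {x. b < a \<bullet> x}) \<union> (Y \<inter> {x. a \<bullet> x = b})" by auto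
  moreover have "Y \<inter> {x. a \<bullet> x = b} \<in> null_sets M"
    using assms hyperplane_null[of a b]
    by (intro null_set_Int1 null_setsI) (auto intro: sets_M)
  moreover have "Y \<inter> {x. b < a \<bullet> x} \<in> sets M" using assms by (auto simp: sets_eq_borel)
  ultimately show ?thesis by (simp add: measure_Un_null_set)
qed

text \<open>The hyperplane through \<open>q\<close> and the centerpoints of all but one of the sets has a fixed fraction
  of each of these sets on both sides; the remaining set chooses the side.\<close>

lemma common_halfspace:
  assumes J: "finite J" "card J \<le> DIM('a)"
    and Y: "\<And>j. j \<in> J \<Longrightarrow> Y j \<in> sets M \<and> 0 < measure M (Y j)"
  shows "\<exists>a. \<forall>j\<in>J. measure M (Y j) / (2 * (DIM('a) + 1)) \<le> measure M (Y j \<inter> {x. a \<bullet> q < a \<bullet> x})"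
proof (cases "J = {}")
  case False
  then obtain j0 where j0: "j0 \<in> J" by auto
  have "\<forall>j\<in>J. \<exists>p. \<forall>a. measure M (Y j) / (2 * (DIM('a) + 1)) \<le> measure M (Y j \<inter> {x. a \<bullet> p \<le> a \<bullet> x})"
    using Y exists_centerpoint by blast
  then obtain p where p: "\<And>j a. j \<in> J \<Longrightarrow>
      measure M (Y j) / (2 * (DIM('a) + 1)) \<le> measure M (Y j \<inter> {x. a \<bullet> p j \<le> a \<bullet> x})"
    by metis
  \<comment> \<open>At most \<open>DIM('a) - 1\<close> difference vectors leave a nonzero normal
    orthogonal to all of them.\<close>
  define D where "D = (\<lambda>j. p j - q) ` (J - {j0})"
  have "dim D \<le> card D" using J by (intro dim_le_card') (auto simp: D_def)
  also have "\<dots> \<le> card (J - {j0})" using J by (auto simp: D_def intro: card_image_le)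
  also have "\<dots> < DIM('a)" using J j0 card_Diff1_less[OF J(1) j0] by linarith
  finally obtain a where a: "a \<noteq> 0" "\<And>y. y \<in> span D \<Longrightarrow> orthogonal a y"
    using orthogonal_to_subspace_exists by blast
  have through: "a \<bullet> p j = a \<bullet> q" if "j \<in> J - {j0}" for j
  proof -
    have "p j - q \<in> span D" using that by (auto simp: D_def intro: span_base)
    from a(2)[OF this] show ?thesis by (simp add: orthogonal_def inner_diff_right)
  qed
  have both: "measure M (Y j) / (2 * (DIM('a) + 1)) \<le> measure M (Y j \<inter> {x. v \<bullet> q < v \<bullet> x})"
    if "j \<in> J - {j0}" "v = a \<or> v = - a" for j v
  proof -
    have "v \<noteq> 0" "v \<bullet> p j = v \<bullet> q" using that a(1) through[OF that(1)] by auto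
    then show ?thesis
      using p[of j v] Y[of j] that measure_Int_open_halfspace[of "Y j" v "v \<bullet> q"] by auto
  qed
  let ?A = "Y j0 \<inter> {x. a \<bullet> q < a \<bullet> x}" and ?B = "Y j0 \<inter> {x. (- a) \<bullet> q < (- a) \<bullet> x}"
  \<comment> \<open>The two open sides cover \<open>Y j0\<close> up to a null hyperplane, so one of
    them carries at least half.\<close>
  have "measure M (Y j0) \<le> measure M (?A \<union> (Y j0 \<inter> {x. (- a) \<bullet> q \<le> (- a) \<bullet> x}))"
  proof (rule finite_measure_mono)
    show "Y j0 \<subseteq> ?A \<union> (Y j0 \<inter> {x. (- a) \<bullet> q \<le> (- a) \<bullet> x})" by (auto simp: not_less)
    show "?A \<union> (Y j0 \<inter> {x. (- a) \<bullet> q \<le> (- a) \<bullet> x}) \<in> sets M"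
      using Y[OF j0] by (intro sets.Un sets.Int halfspace_sets) auto
  qed
  also have "\<dots> \<le> measure M ?A + measure M (Y j0 \<inter> {x. (- a) \<bullet> q \<le> (- a) \<bullet> x})"
    using Y[OF j0] by (intro measure_Un_le sets.Int halfspace_sets) auto
  also have "measure M (Y j0 \<inter> {x. (- a) \<bullet> q \<le> (- a) \<bullet> x}) = measure M ?B"
    using Y[OF j0] a(1) measure_Int_open_halfspace[of "Y j0" "- a" "- a \<bullet> q"] by simp
  finally have "measure M (Y j0) / 2 \<le> measure M ?A \<or> measure M (Y j0) / 2 \<le> measure M ?B"
    by linarith
  then obtain v where v: "v = a \<or> v = - a"
      "measure M (Y j0) / 2 \<le> measure M (Y j0 \<inter> {x. v \<bullet> q < v \<bullet> x})"
    by blast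
  have "measure M (Y j0) / (2 * (DIM('a) + 1)) \<le> measure M (Y j0) / 2"
    by (intro divide_left_mono) auto
  from order_trans[OF this v(2)]
  have "measure M (Y j) / (2 * (DIM('a) + 1)) \<le> measure M (Y j \<inter> {x. v \<bullet> q < v \<bullet> x})"
    if "j \<in> J" for j
    using both[OF _ v(1), of j] that by (cases "j = j0") blast+
  then show ?thesis by blast
qed simp

text \<open>Each index in turn gets a half-space containing the sets of all other indices; each of
  the \<open>DIM('a) + 1\<close> rounds costs one factor
  \<open>1 / (2 * (DIM('a) + 1))\<close>.\<close>

lemma positive_fraction_homogeneous:
  assumes I: "finite I" "card I = DIM('a) + 1" and Y: "\<And>j. j \<in> I \<Longrightarrow> Y j \<in> sets M"
  shows "\<exists>Z. (\<forall>j\<in>I. Z j \<subseteq> Y j \<and> Z j \<in> sets M \<and>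
      (1 / (2 * (DIM('a) + 1))) ^ (DIM('a) + 1) * measure M (Y j) \<le> measure M (Z j)) \<and>
    homogeneous_wrt q I Z"
proof (cases "\<exists>i\<in>I. measure M (Y i) = 0")
  case True
  then obtain i where i: "i \<in> I" "measure M (Y i) = 0" by auto
  have "(1 / (2 * (DIM('a) + 1))) ^ (DIM('a) + 1) * measure M (Y j) \<le> measure M (Y j)" for j
    by (intro mult_left_le_one_le power_le_one) auto
  \<comment> \<open>A null set has no fraction to preserve and may be emptied, which makes the tuple
    vacuously homogeneous.\<close>
  then show ?thesis
    using i Y by (intro exI[of _ "Y(i := {})"]) (auto simp: homogeneous_wrt_def)
next
  case False
  define c :: real where "c = 1 / (2 * (DIM('a) + 1))"
  have c: "0 < c" "c \<le> 1" by (auto simp: c_def)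
  have "\<exists>Z. (\<forall>j\<in>I. Z j \<subseteq> Y j \<and> Z j \<in> sets M \<and> c ^ card F * measure M (Y j) \<le> measure M (Z j)) \<and>
      (\<forall>i\<in>F. \<exists>a. \<forall>j\<in>I - {i}. \<forall>x\<in>Z j. 0 < a \<bullet> (x - q))" if "F \<subseteq> I" for F
    using finite_subset[OF that I(1)] that
  proof (induction F)
    case empty
    show ?case using Y by (intro exI[of _ Y]) auto
  next
    case (insert i F)
    have "F \<subseteq> I" using insert.prems by simp
    from insert.IH[OF this] obtain Z where Z0: "\<forall>j\<in>I. Z j \<subseteq> Y j \<and> Z j \<in> sets M \<and> c ^ card F * measure M (Y j) \<le> measure M (Z j)"
        "\<forall>i\<in>F. \<exists>a. \<forall>j\<in>I - {i}. \<forall>x\<in>Z j. 0 < a \<bullet> (x - q)"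
      by (elim exE conjE)
    have Z: "\<And>j. j \<in> I \<Longrightarrow> Z j \<subseteq> Y j \<and> Z j \<in> sets M"
        "\<And>j. j \<in> I \<Longrightarrow> c ^ card F * measure M (Y j) \<le> measure M (Z j)"
        "\<And>i. i \<in> F \<Longrightarrow> \<exists>a. \<forall>j\<in>I - {i}. \<forall>x\<in>Z j. 0 < a \<bullet> (x - q)"
      using Z0 by blast+
    have pos: "0 < measure M (Z j)" if "j \<in> I" for j
    proof -
      have "0 < measure M (Y j)" using False that by (simp add: zero_less_measure_iff)
      then have "0 < c ^ card F * measure M (Y j)" using c by simp
      then show ?thesis using Z(2)[OF that] by linarith
    qed
    have "card (I - {i}) \<le> DIM('a)" using I insert.prems by simp
    then obtain a where "\<forall>j\<in>I - {i}. measure M (Z j) / (2 * (DIM('a) + 1)) \<le> measure M (Z j \<inter> {x. a \<bullet> q < a \<bullet> x})"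
      using common_halfspace[of "I - {i}" Z q] Z(1) pos I by auto
    then have a: "c * measure M (Z j) \<le> measure M (Z j \<inter> {x. a \<bullet> q < a \<bullet> x})" if "j \<in> I - {i}" for j
      using that by (simp add: c_def)
    \<comment> \<open>Only the sets other than \<open>Z i\<close> are cut; earlier half-spaces stay
      valid because sets only shrink.\<close>
    define Z' where "Z' j = (if j = i then Z j else Z j \<inter> {x. a \<bullet> q < a \<bullet> x})" for j
    have le: "c * measure M (Z j) \<le> measure M (Z' j)" if "j \<in> I" for j
      using a[of j] that c by (auto simp: Z'_def mult_left_le_one_le)
    show ?case
    proof (intro exI[of _ Z'] conjI ballI)
      fix j assume j: "j \<in> I"
      show "Z' j \<subseteq> Y j" "Z' j \<in> sets M" using Z(1)[OF j] halfspace_sets(1) by (auto simp: Z'_def)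
      have "c ^ card (insert i F) * measure M (Y j) = c * (c ^ card F * measure M (Y j))"
        using insert.hyps by simp
      also have "\<dots> \<le> c * measure M (Z j)" using Z(2)[OF j] c by (intro mult_left_mono) auto
      also note le[OF j]
      finally show "c ^ card (insert i F) * measure M (Y j) \<le> measure M (Z' j)" .
    next
      fix k assume "k \<in> insert i F"
      then show "\<exists>a. \<forall>j\<in>I - {k}. \<forall>x\<in>Z' j. 0 < a \<bullet> (x - q)"
      proof
        assume "k = i"
        then show ?thesis by (intro exI[of _ a]) (auto simp: Z'_def inner_diff_right)
      next
        assume "k \<in> F"
        from Z(3)[OF this] show ?thesis by (auto simp: Z'_def)
      qed
    qed
  qed
  from this[OF subset_refl] obtain Z where Z: "\<forall>j\<in>I. Z j \<subseteq> Y j \<and> Z j \<in> sets M \<and>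
      c ^ (DIM('a) + 1) * measure M (Y j) \<le> measure M (Z j)"
      "\<forall>i\<in>I. \<exists>a. \<forall>j\<in>I - {i}. \<forall>x\<in>Z j. 0 < a \<bullet> (x - q)"
    unfolding I(2) by (elim exE conjE)
  have "homogeneous_wrt q I Z" using I Z(2) by (intro homogeneous_wrt_if_halfspaces) blast+
  with Z(1) show ?thesis unfolding c_def by blast
qed

end

section \<open>Regular partitions\<close>

text \<open>The cells of the Venn diagram of \<open>G\<close>. Each is the class of a point, so none
  is empty, and \<open>G = {}\<close> gives the single cell \<open>UNIV\<close>.\<close>

definition atoms :: "'a set set \<Rightarrow> 'a set set" where
  "atoms G = range (\<lambda>x. {y. \<forall>A\<in>G. x \<in> A \<longleftrightarrow> y \<in> A})"

lemma atoms_disjoint: "pairwise disjnt (atoms G)"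
  by (auto simp: atoms_def pairwise_def disjnt_iff)

lemma Union_atoms: "\<Union>(atoms G) = UNIV"
  by (auto simp: atoms_def)

lemma atoms_subset_or_disjoint: "C \<in> atoms G \<Longrightarrow> A \<in> G \<Longrightarrow> C \<subseteq> A \<or> C \<inter> A = {}"
  by (auto simp: atoms_def)

lemma atoms_refine:
  assumes "G \<subseteq> G'" "C \<in> atoms G'"
  shows "\<exists>D\<in>atoms G. C \<subseteq> D"
  using assms by (fastforce simp: atoms_def)

lemma atoms_image: "atoms G = (\<lambda>H. {y. \<forall>A\<in>G. A \<in> H \<longleftrightarrow> y \<in> A}) ` range (\<lambda>x. {A \<in> G. x \<in> A})"
  by (auto simp: atoms_def image_image intro!: image_cong)

lemma finite_atoms:
  assumes "finite G"
  shows "finite (atoms G)" "card (atoms G) \<le> 2 ^ card G"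
proof -
  have sub: "range (\<lambda>x. {A \<in> G. x \<in> A}) \<subseteq> Pow G" by auto
  then have fin: "finite (range (\<lambda>x. {A \<in> G. x \<in> A}))"
    using assms by (meson finite_Pow_iff finite_subset)
  then show "finite (atoms G)" unfolding atoms_image by blast
  have "card (atoms G) \<le> card (range (\<lambda>x. {A \<in> G. x \<in> A}))"
    unfolding atoms_image using fin by (rule card_image_le)
  also have "\<dots> \<le> card (Pow G)" using sub assms by (intro card_mono) auto
  finally show "card (atoms G) \<le> 2 ^ card G" using assms by (simp add: card_Pow)
qed

lemma atoms_measurable:
  assumes "finite G" "G \<subseteq> sets M" "space M = UNIV" "C \<in> atoms G"
  shows "C \<in> sets M"
proof -
  obtain x where "C = {y. \<forall>A\<in>G. x \<in> A \<longleftrightarrow> y \<in> A}" using assms(4) by (auto simp: atoms_def)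
  then have "C = space M - (\<Union>A\<in>G. if x \<in> A then space M - A else A)"
    using assms(3) by (auto split: if_splits)
  moreover have "(\<Union>A\<in>G. if x \<in> A then space M - A else A) \<in> sets M"
    using assms(1,2) by (intro sets.finite_UN) auto
  ultimately show ?thesis by auto
qed

text \<open>Bounds the number of generating sets after each round: \<open>b\<close> sets have at
  most \<open>2 ^ b\<close> atoms, and every \<open>r\<close>-tuple of atoms contributes at most
  \<open>r\<close> new sets.\<close>

primrec refinement_bound :: "nat \<Rightarrow> nat \<Rightarrow> nat" where
  "refinement_bound r 0 = 0"
| "refinement_bound r (Suc n) = refinement_bound r n + r * (2 ^ refinement_bound r n) ^ r"

text \<open>Refinement uses two properties of homogeneity: it survives shrinking, and it can be
  reached by keeping a fraction \<open>c\<close> of each set.\<close>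

locale positive_fraction = finite_measure M for M :: "'a measure" +
  fixes r :: nat and good :: "(nat \<Rightarrow> 'a set) \<Rightarrow> bool" and c :: real
  assumes space_UNIV: "space M = UNIV"
    and good_mono: "\<And>u v. good u \<Longrightarrow> (\<And>j. j < r \<Longrightarrow> v j \<subseteq> u j) \<Longrightarrow> good v"
    and c_pos: "0 < c" and c_le_1: "c \<le> 1"
    and exists_good: "\<And>Y. (\<And>j. j < r \<Longrightarrow> Y j \<in> sets M) \<Longrightarrow>
      \<exists>Z. (\<forall>j<r. Z j \<subseteq> Y j \<and> Z j \<in> sets M \<and> c * measure M (Y j) \<le> measure M (Z j)) \<and> good Z"
begin

text \<open>Cells may repeat in a tuple, since several parts of the equipartition may lie in one
  cell.\<close>

definition bad_tuples :: "'a set set \<Rightarrow> (nat \<Rightarrow> 'a set) set" where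
  "bad_tuples P = {u \<in> {..<r} \<rightarrow>\<^sub>E P. \<not> good u}"

definition weight :: "(nat \<Rightarrow> 'a set) \<Rightarrow> real" where
  "weight u = (\<Prod>j<r. measure M (u j))"

definition defect :: "'a set set \<Rightarrow> real" where
  "defect P = (\<Sum>u\<in>bad_tuples P. weight u)"

lemma weight_nonneg: "0 \<le> weight u"
  by (simp add: weight_def prod_nonneg)

lemma finite_bad_tuples: "finite P \<Longrightarrow> finite (bad_tuples P)"
  by (simp add: bad_tuples_def finite_PiE)

lemma measure_saturated:
  assumes G: "finite G" "G \<subseteq> sets M"
    and sat: "\<And>C. C \<in> atoms G \<Longrightarrow> C \<subseteq> S \<or> C \<inter> S = {}"
  shows "measure M S = (\<Sum>C\<in>{C\<in>atoms G. C \<subseteq> S}. measure M C)"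
proof -
  have "S = \<Union>{C\<in>atoms G. C \<subseteq> S}" using sat Union_atoms[of G] by blast
  moreover have "measure M (\<Union>{C\<in>atoms G. C \<subseteq> S}) = (\<Sum>C\<in>{C\<in>atoms G. C \<subseteq> S}. measure M C)"
  proof (rule measure_Union')
    show "C \<in> fmeasurable M" if "C \<in> {C\<in>atoms G. C \<subseteq> S}" for C
      using that atoms_measurable[OF G space_UNIV] by (auto simp: fmeasurable_eq_sets)
    show "pairwise disjnt {C\<in>atoms G. C \<subseteq> S}" using atoms_disjoint by (rule pairwise_subset) auto
  qed (use finite_atoms[OF G(1)] in auto)
  ultimately show ?thesis by simp
qed

text \<open>Each \<open>S j\<close> is a disjoint union of atoms; expanding the product of the sums
  of their measures gives one term per tuple of atoms.\<close>

lemma sum_weight_saturated: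
  assumes G: "finite G" "G \<subseteq> sets M"
    and sat: "\<And>C j. C \<in> atoms G \<Longrightarrow> j < r \<Longrightarrow> C \<subseteq> S j \<or> C \<inter> S j = {}"
  shows "(\<Sum>u\<in>PiE {..<r} (\<lambda>j. {C\<in>atoms G. C \<subseteq> S j}). weight u) = (\<Prod>j<r. measure M (S j))"
proof -
  have "(\<Prod>j<r. measure M (S j)) = (\<Prod>j<r. \<Sum>C\<in>{C\<in>atoms G. C \<subseteq> S j}. measure M C)"
    using measure_saturated[OF G sat] by (intro prod.cong) auto
  also have "\<dots> = (\<Sum>u\<in>PiE {..<r} (\<lambda>j. {C\<in>atoms G. C \<subseteq> S j}). weight u)"
    unfolding weight_def using finite_atoms[OF G(1)] by (intro prod_sum_PiE) auto
  finally show ?thesis by simp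
qed

lemma defect_le:
  assumes G: "finite G" "G \<subseteq> sets M"
  shows "defect (atoms G) \<le> measure M UNIV ^ r"
proof -
  have "defect (atoms G) \<le> (\<Sum>u\<in>PiE {..<r} (\<lambda>j. {C\<in>atoms G. C \<subseteq> UNIV}). weight u)"
    unfolding defect_def using finite_atoms[OF G(1)]
    by (intro sum_mono2 finite_PiE) (auto simp: bad_tuples_def weight_nonneg)
  also have "\<dots> = measure M UNIV ^ r"
    using sum_weight_saturated[OF G, of "\<lambda>_. UNIV"] by simp
  finally show ?thesis .
qed

text \<open>Inside each bad tuple the good sub-box carries a fraction \<open>c ^ r\<close> of its weight, and subtuples
  of good tuples stay good.\<close>

lemma refine_step:
  assumes G: "finite G" "G \<subseteq> sets M"
  shows "\<exists>G'. finite G' \<and> G' \<subseteq> sets M \<and> card G' \<le> card G + r * (2 ^ card G) ^ r \<and>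
    defect (atoms G') \<le> (1 - c ^ r) * defect (atoms G)"
proof -
  let ?P = "atoms G"
  define U where "U = {..<r} \<rightarrow>\<^sub>E ?P"
  have "\<exists>Z. (\<forall>j<r. Z j \<subseteq> u j \<and> Z j \<in> sets M \<and> c * measure M (u j) \<le> measure M (Z j)) \<and> good Z"
    if "u \<in> U" for u
    using that atoms_measurable[OF G space_UNIV] by (intro exists_good) (auto simp: U_def)
  then obtain Z where Z: "\<And>u j. u \<in> U \<Longrightarrow> j < r \<Longrightarrow> Z u j \<subseteq> u j \<and> Z u j \<in> sets M"
      "\<And>u j. u \<in> U \<Longrightarrow> j < r \<Longrightarrow> c * measure M (u j) \<le> measure M (Z u j)"
      "\<And>u. u \<in> U \<Longrightarrow> good (Z u)"
    by metis
  define N where "N = (\<lambda>(u, j). Z u j) ` (U \<times> {..<r})"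
  define G' where "G' = G \<union> N"
  have finU: "finite U" using finite_atoms[OF G(1)] by (auto simp: U_def intro: finite_PiE)
  have G': "finite G'" "G' \<subseteq> sets M" using G finU Z(1) by (auto simp: G'_def N_def)
  have "card N \<le> card (U \<times> {..<r})" unfolding N_def using finU by (intro card_image_le) auto
  also have "\<dots> = r * card ?P ^ r" using finU by (simp add: card_cartesian_product U_def card_PiE)
  also have "\<dots> \<le> r * (2 ^ card G) ^ r"
    using finite_atoms(2)[OF G(1)] by (intro mult_left_mono power_mono) auto
  finally have card: "card G' \<le> card G + r * (2 ^ card G) ^ r"
    unfolding G'_def using card_Un_le[of G N] by linarith
  define K where "K S = {C\<in>atoms G'. C \<subseteq> S}" for S
  \<comment> \<open>The tuples of new atoms inside the box of \<open>u\<close> but outside its good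
    sub-box; no others in the box can be bad.\<close>
  define Q where "Q u = PiE {..<r} (\<lambda>j. K (u j)) - PiE {..<r} (\<lambda>j. K (Z u j))" for u
  have finQ: "finite (Q u)" for u
    using finite_atoms[OF G'(1)] by (auto simp: Q_def K_def intro!: finite_PiE)
  \<comment> \<open>The tuple \<open>u\<close> of old atoms around a bad tuple \<open>v\<close> is
    itself bad, since goodness passes to subsets, and \<open>v\<close> avoids the good sub-box of
    \<open>u\<close>.\<close>
  have "bad_tuples (atoms G') \<subseteq> (\<Union>u\<in>bad_tuples ?P. Q u)"
  proof
    fix v assume v: "v \<in> bad_tuples (atoms G')"
    have "\<forall>j<r. \<exists>D\<in>?P. v j \<subseteq> D"
    proof (intro allI impI)
      fix j assume "j < r"
      then have "v j \<in> atoms G'" using v by (auto simp: bad_tuples_def)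
      then show "\<exists>D\<in>?P. v j \<subseteq> D" by (intro atoms_refine[of G G']) (auto simp: G'_def)
    qed
    then obtain D where D: "\<And>j. j < r \<Longrightarrow> D j \<in> ?P \<and> v j \<subseteq> D j" by metis
    define u where "u = restrict D {..<r}"
    have u: "u \<in> U" using D by (auto simp: U_def u_def)
    have "\<not> good u" using v D good_mono[of u v] by (auto simp: bad_tuples_def u_def)
    moreover have "v \<notin> PiE {..<r} (\<lambda>j. K (Z u j))"
    proof
      assume "v \<in> PiE {..<r} (\<lambda>j. K (Z u j))"
      then have "good v" using good_mono[OF Z(3)[OF u]] by (auto simp: K_def PiE_iff)
      then show False using v by (simp add: bad_tuples_def)
    qed
    moreover have "v \<in> PiE {..<r} (\<lambda>j. K (u j))"
      using v D by (auto simp: bad_tuples_def K_def u_def PiE_iff)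
    ultimately show "v \<in> (\<Union>u\<in>bad_tuples ?P. Q u)"
      using u by (auto simp: bad_tuples_def Q_def U_def)
  qed
  then have "defect (atoms G') \<le> (\<Sum>v\<in>(\<Union>u\<in>bad_tuples ?P. Q u). weight v)"
    unfolding defect_def using finQ finite_bad_tuples finite_atoms[OF G(1)] weight_nonneg
    by (intro sum_mono2) auto
  also have "\<dots> \<le> (\<Sum>u\<in>bad_tuples ?P. \<Sum>v\<in>Q u. weight v)"
  proof -
    have "(\<Sum>v\<in>(\<Union>u\<in>T. Q u). weight v) \<le> (\<Sum>u\<in>T. \<Sum>v\<in>Q u. weight v)" if "finite T" for T
      using that
    proof (induction T)
      case (insert u T)
      have "(\<Sum>v\<in>Q u \<union> (\<Union>u\<in>T. Q u). weight v) \<le> (\<Sum>v\<in>Q u. weight v) + (\<Sum>v\<in>(\<Union>u\<in>T. Q u). weight v)"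
        using sum.union_inter[of "Q u" "\<Union>u\<in>T. Q u" weight] finQ insert.hyps
          sum_nonneg[of "Q u \<inter> (\<Union>u\<in>T. Q u)" weight] weight_nonneg by simp
      then show ?case using insert by simp
    qed simp
    then show ?thesis using finite_bad_tuples finite_atoms[OF G(1)] by blast
  qed
  also have "\<dots> \<le> (\<Sum>u\<in>bad_tuples ?P. (1 - c ^ r) * weight u)"
  proof (rule sum_mono)
    fix u assume "u \<in> bad_tuples ?P"
    then have u: "u \<in> U" by (auto simp: bad_tuples_def U_def)
    have sub: "PiE {..<r} (\<lambda>j. K (Z u j)) \<subseteq> PiE {..<r} (\<lambda>j. K (u j))"
      using Z(1)[OF u] by (intro PiE_mono) (auto simp: K_def)
    have satu: "C \<subseteq> u j \<or> C \<inter> u j = {}" if C: "C \<in> atoms G'" and j: "j < r" for C j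
    proof -
      obtain D where D: "D \<in> ?P" "C \<subseteq> D" using atoms_refine[OF _ C, of G] by (auto simp: G'_def)
      moreover have "u j \<in> ?P" using u j by (auto simp: U_def)
      ultimately show ?thesis
        using pairwiseD[OF atoms_disjoint, of D G "u j"] by (auto simp: disjnt_def)
    qed
    have satZ: "C \<subseteq> Z u j \<or> C \<inter> Z u j = {}" if "C \<in> atoms G'" "j < r" for C j
      using that u by (intro atoms_subset_or_disjoint[of C G']) (auto simp: G'_def N_def)
    \<comment> \<open>Old atoms and the sets \<open>Z u j\<close> are unions of new atoms, so the
      weight of \<open>Q u\<close> is a difference of two products of measures.\<close>
    have "(\<Sum>v\<in>Q u. weight v) = (\<Sum>v\<in>PiE {..<r} (\<lambda>j. K (u j)). weight v) - (\<Sum>v\<in>PiE {..<r} (\<lambda>j. K (Z u j)). weight v)"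
      unfolding Q_def using sub finite_atoms[OF G'(1)]
      by (intro sum_diff) (auto simp: K_def intro!: finite_PiE)
    also have "\<dots> = weight u - (\<Prod>j<r. measure M (Z u j))"
      using sum_weight_saturated[OF G' satu] sum_weight_saturated[OF G' satZ]
      by (simp add: K_def weight_def)
    also have "\<dots> \<le> weight u - (\<Prod>j<r. c * measure M (u j))"
      using Z(2)[OF u] c_pos by (intro diff_left_mono prod_mono) auto
    also have "\<dots> = (1 - c ^ r) * weight u"
      by (simp add: weight_def prod.distrib algebra_simps)
    finally show "(\<Sum>v\<in>Q u. weight v) \<le> (1 - c ^ r) * weight u" .
  qed
  also have "\<dots> = (1 - c ^ r) * defect ?P" by (simp add: defect_def sum_distrib_left)
  finally show ?thesis using G' card by blast
qed

lemma refine_iterate: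
  "\<exists>G. finite G \<and> G \<subseteq> sets M \<and> card G \<le> refinement_bound r n \<and>
    defect (atoms G) \<le> (1 - c ^ r) ^ n * measure M UNIV ^ r"
proof (induction n)
  case 0
  show ?case using defect_le[of "{}"] by (intro exI[of _ "{}"]) auto
next
  case (Suc n)
  then obtain G where G: "finite G" "G \<subseteq> sets M" "card G \<le> refinement_bound r n"
    "defect (atoms G) \<le> (1 - c ^ r) ^ n * measure M UNIV ^ r" by blast
  obtain G' where G': "finite G'" "G' \<subseteq> sets M" "card G' \<le> card G + r * (2 ^ card G) ^ r"
    "defect (atoms G') \<le> (1 - c ^ r) * defect (atoms G)"
    using refine_step[OF G(1,2)] by blast
  have "card G + r * (2 ^ card G) ^ r \<le> refinement_bound r (Suc n)"
    using G(3) by (auto intro!: add_mono mult_left_mono power_mono power_increasing)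
  moreover have "(1 - c ^ r) * defect (atoms G) \<le> (1 - c ^ r) * ((1 - c ^ r) ^ n * measure M UNIV ^ r)"
    using G(4) c_pos c_le_1 by (intro mult_left_mono) (auto simp: power_le_one)
  ultimately show ?case using G' by (intro exI[of _ G']) (auto simp: mult.assoc)
qed

end

section \<open>Equipartitions\<close>

context hyperplane_null_measure
begin

text \<open>Sweep \<open>S\<close> by parallel hyperplanes: as these are null, the measure swept
  depends continuously on the position and takes every intermediate value.\<close>

lemma exists_subset_of_measure:
  assumes S: "S \<in> sets M" and t: "0 \<le> t" "t \<le> measure M S"
  shows "\<exists>T\<subseteq>S. T \<in> sets M \<and> measure M T = t"
proof (cases "t = 0 \<or> t = measure M S")
  case True
  then show ?thesis using S by (metis empty_subsetI measure_empty sets.empty_sets subset_refl)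
next
  case False
  then have t: "0 < t" "t < measure M S" using t by auto
  obtain a :: 'a where a: "a \<in> Basis" using nonempty_Basis by blast
  \<comment> \<open>The pushforward to a coordinate axis; its distribution function is the measure
    swept.\<close>
  define N where "N = distr (restrict_space M S) borel (\<lambda>x. a \<bullet> x)"
  have meas: "(\<lambda>x. a \<bullet> x) \<in> measurable (restrict_space M S) borel"
  proof (rule measurable_restrict_space1)
    have "(\<lambda>x. a \<bullet> x) \<in> borel_measurable borel" by measurable
    then show "(\<lambda>x. a \<bullet> x) \<in> borel_measurable M"
      using measurable_cong_sets[OF sets_eq_borel refl] by blast
  qed
  have N: "measure N A = measure M (S \<inter> {x. a \<bullet> x \<in> A})" if "A \<in> sets borel" for A
  proof -
    have "measure N A = measure (restrict_space M S) ((\<lambda>x. a \<bullet> x) -` A \<inter> space (restrict_space M S))"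
      unfolding N_def using meas that by (rule measure_distr)
    also have "(\<lambda>x. a \<bullet> x) -` A \<inter> space (restrict_space M S) = S \<inter> {x. a \<bullet> x \<in> A}"
      using space_M by (auto simp: space_restrict_space)
    also have "measure (restrict_space M S) (S \<inter> {x. a \<bullet> x \<in> A}) = measure M (S \<inter> {x. a \<bullet> x \<in> A})"
      using S by (intro measure_restrict_space) (auto simp: space_M)
    finally show ?thesis .
  qed
  interpret R: finite_measure "restrict_space M S"
    using S by (intro finite_measure_restrict_space finite_measure_axioms) (simp add: space_M)
  interpret N: finite_borel_measure N
    using R.finite_measure_distr[OF meas] by (intro finite_borel_measure.intro) (auto simp: N_def finite_borel_measure_axioms_def)
  have cont: "continuous_on UNIV (cdf N)"
  proof -
    have "measure N {z} = 0" for z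
    proof -
      have "measure N {z} = measure M (S \<inter> {x. a \<bullet> x = z})" using N[of "{z}"] by simp
      also have "\<dots> \<le> measure M {x. a \<bullet> x = z}"
        by (intro finite_measure_mono sets_M) auto
      also have "\<dots> = 0" using hyperplane_null[of a z] a nonzero_Basis[OF a] by (simp add: measure_def)
      finally show ?thesis using measure_nonneg[of N "{z}"] by linarith
    qed
    then show ?thesis using N.isCont_cdf by (auto intro: continuous_at_imp_continuous_on)
  qed
  have tot: "measure N (space N) = measure M S"
    using N[of UNIV] by (simp add: N_def)
  have "eventually (\<lambda>z. cdf N z < t) at_bot"
    using N.cdf_lim_at_bot t by (intro order_tendstoD(2)) auto
  then obtain x where x: "cdf N x < t" by (auto simp: eventually_at_bot_linorder)
  have "eventually (\<lambda>z. t < cdf N z) at_top"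
    using N.cdf_lim_at_top t tot by (intro order_tendstoD(1)) auto
  then obtain y where y: "t < cdf N y" by (auto simp: eventually_at_top_linorder)
  have "x \<le> y" using N.cdf_nondecreasing[of y x] x y by linarith
  then obtain z where z: "cdf N z = t"
    using IVT'[of "cdf N" x t y] x y continuous_on_subset[OF cont, of "{x..y}"] by auto
  have "measure M (S \<inter> {x. a \<bullet> x \<le> z}) = t"
    using z N[of "{..z}"] by (simp add: cdf_def)
  moreover have "S \<inter> {x. a \<bullet> x \<le> z} \<in> sets M" using S by (simp add: sets_eq_borel)
  ultimately show ?thesis by blast
qed

lemma exists_equal_split:
  assumes "S \<in> sets M" "0 \<le> t" "measure M S = real (Suc n) * t"
  shows "\<exists>A. (\<forall>i<Suc n. A i \<in> sets M \<and> measure M (A i) = t) \<and>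
    disjoint_family_on A {..<Suc n} \<and> (\<Union>i<Suc n. A i) = S"
  using assms
proof (induction n arbitrary: S)
  case 0
  then show ?case by (intro exI[of _ "\<lambda>_. S"]) (auto simp: disjoint_family_on_def)
next
  case (Suc n)
  then obtain T where T: "T \<subseteq> S" "T \<in> sets M" "measure M T = t"
    using exists_subset_of_measure[of S t] by (auto simp: algebra_simps)
  have "measure M (S - T) = real (Suc n) * t"
    using T Suc.prems finite_measure_Diff[of S T] by (simp add: algebra_simps)
  then obtain A where A: "\<forall>i<Suc n. A i \<in> sets M \<and> measure M (A i) = t"
      "disjoint_family_on A {..<Suc n}" "(\<Union>i<Suc n. A i) = S - T"
    using Suc.IH[of "S - T"] Suc.prems T by auto
  show ?case
  proof (intro exI[of _ "A(Suc n := T)"] conjI)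
    show "\<forall>i<Suc (Suc n). (A(Suc n := T)) i \<in> sets M \<and> measure M ((A(Suc n := T)) i) = t"
      using A(1) T by (auto simp: less_Suc_eq)
    have sub: "A i \<inter> T = {}" if "i < Suc n" for i using A(3) that by blast
    show "disjoint_family_on (A(Suc n := T)) {..<Suc (Suc n)}"
    proof -
      have "disjoint_family_on (A(Suc n := T)) {..<Suc n}"
        using A(2) by (simp add: disjoint_family_on_def)
      then show ?thesis
        using sub unfolding lessThan_Suc[of "Suc n"]
        by (subst disjoint_family_on_insert) auto
    qed
    have "(\<Union>i<Suc (Suc n). (A(Suc n := T)) i) = (\<Union>i<Suc n. A i) \<union> T"
      by (auto simp: lessThan_Suc[of "Suc n"] split: if_splits)
    then show "(\<Union>i<Suc (Suc n). (A(Suc n := T)) i) = S" using A(3) T(1) by auto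
  qed
qed

text \<open>\<open>X\<close> indexes the parts not known to lie in a single cell. They come from cutting up what is left
  when no cell has room for another part (or only one part is missing), so that there are at most
  as many of them as cells.\<close>

lemma exists_equipartition:
  fixes k :: nat
  assumes P: "finite P" "P \<subseteq> sets M" "\<Union>P = UNIV"
    and k: "0 < k" and pos: "0 < measure M UNIV"
  shows "\<exists>A cell X. X \<subseteq> {1..k} \<and> card X \<le> card P \<and> disjoint_family_on A {1..k} \<and> (\<Union>i\<in>{1..k}. A i) = UNIV \<and>
    (\<forall>i\<in>{1..k}. A i \<in> sets M \<and> measure M (A i) = measure M UNIV / k) \<and>
    (\<forall>i\<in>{1..k} - X. cell i \<in> P \<and> A i \<subseteq> cell i)"
proof -
  define t where "t = measure M UNIV / k"
  have t: "0 < t" "real k * t = measure M UNIV" using k pos by (auto simp: t_def)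
  define pure where "pure N A cell \<longleftrightarrow> disjoint_family_on A {1..N} \<and>
    (\<forall>i\<in>{1..N}. A i \<in> sets M \<and> measure M (A i) = t \<and> cell i \<in> P \<and> A i \<subseteq> cell i)"
    for N :: nat and A cell :: "nat \<Rightarrow> 'a set"
  \<comment> \<open>Requiring \<open>N < k\<close> leaves at least one part to be cut from the
    remainder; with \<open>N = k\<close> a null remainder could stay uncovered.\<close>
  define Ns where "Ns = {N. N < k \<and> (\<exists>A cell. pure N A cell)}"
  have "finite Ns" "0 \<in> Ns" using k by (auto simp: Ns_def pure_def disjoint_family_on_def)
  define N where "N = Max Ns"
  have "N \<in> Ns" using \<open>finite Ns\<close> \<open>0 \<in> Ns\<close> unfolding N_def by (intro Max_in) auto
  then obtain A cell where N: "N < k" and pure: "pure N A cell" by (auto simp: Ns_def)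
  have maximal: "Suc N \<notin> Ns"
    using Max_ge[OF \<open>finite Ns\<close>, of "Suc N"] by (auto simp: N_def)
  define R where "R = UNIV - (\<Union>i\<in>{1..N}. A i)"
  have A: "A i \<in> sets M" "measure M (A i) = t" "cell i \<in> P" "A i \<subseteq> cell i" if "i \<in> {1..N}" for i
    using pure that by (auto simp: pure_def)
  have disj: "disjoint_family_on A {1..N}" using pure by (simp add: pure_def)
  have UA: "(\<Union>i\<in>{1..N}. A i) \<in> sets M" using A(1) by (intro sets.finite_UN) auto
  then have R_sets: "R \<in> sets M" unfolding R_def by (metis sets.compl_sets space_M)
  have "measure M (\<Union>i\<in>{1..N}. A i) = (\<Sum>i\<in>{1..N}. measure M (A i))"
    using A(1) disj by (intro measure_finite_Union) (auto simp: emeasure_eq_measure)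
  also have "\<dots> = real N * t" using A(2) by simp
  finally have R: "measure M R = real (k - N) * t"
    using finite_measure_compl[OF UA] t N by (simp add: R_def space_M of_nat_diff algebra_simps)
  have "P \<noteq> {}" using P by auto
  have "k - N \<le> card P"
  proof (cases "Suc N < k")
    case False
    then show ?thesis using N P \<open>P \<noteq> {}\<close> card_gt_0_iff[of P] by linarith
  next
    case True
    \<comment> \<open>A cell with more than \<open>t\<close> left would supply one more pure part,
      against maximality of \<open>N\<close>.\<close>
    have less: "measure M (C \<inter> R) \<le> t" if C: "C \<in> P" for C
    proof (rule ccontr)
      assume "\<not> ?thesis"
      then obtain T where T: "T \<subseteq> C \<inter> R" "T \<in> sets M" "measure M T = t"
        using exists_subset_of_measure[of "C \<inter> R" t] C P R_sets t by auto
      have "(A(Suc N := T)) (Suc N) \<inter> (\<Union>i\<in>{1..N}. (A(Suc N := T)) i) = {}"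
        using T(1) by (auto simp: R_def)
      moreover have "disjoint_family_on (A(Suc N := T)) {1..N}"
        using disj by (simp add: disjoint_family_on_def)
      ultimately have "disjoint_family_on (A(Suc N := T)) (insert (Suc N) {1..N})"
        by (subst disjoint_family_on_insert) simp_all
      moreover have insert: "{1..Suc N} = insert (Suc N) {1..N}" by auto
      ultimately have "pure (Suc N) (A(Suc N := T)) (cell(Suc N := C))"
        using A T C unfolding pure_def insert by auto
      then show False using maximal True by (auto simp: Ns_def)
    qed
    have "(\<Union>C\<in>P. C \<inter> R) = R" using P(3) by auto
    then have "real (k - N) * t \<le> measure M (\<Union>C\<in>P. C \<inter> R)" using R by simp
    also have "\<dots> \<le> (\<Sum>C\<in>P. measure M (C \<inter> R))"
      using P R_sets by (intro measure_UNION_le) auto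
    also have "\<dots> \<le> real (card P) * t" using less by (intro sum_bounded_above) simp
    finally show ?thesis using t by simp
  qed
  obtain l where l: "k - N = Suc l" using N by (cases "k - N") auto
  obtain B where B: "\<forall>i<Suc l. B i \<in> sets M \<and> measure M (B i) = t"
      "disjoint_family_on B {..<Suc l}" "(\<Union>i<Suc l. B i) = R"
    using exists_equal_split[OF R_sets, of t l] t R l by auto
  \<comment> \<open>\<open>A\<close> is numbered from 1 and \<open>B\<close> from 0, hence the shift
    by \<open>Suc N\<close>.\<close>
  define E where "E i = (if i \<le> N then A i else B (i - Suc N))" for i
  have E1: "E i = A i" if "i \<in> {1..N}" for i using that by (simp add: E_def)
  have E2: "E i = B (i - Suc N)" "i - Suc N < Suc l" if "i \<in> {Suc N..k}" for i
    using that l by (auto simp: E_def)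
  have split: "{1..k} = {1..N} \<union> {Suc N..k}" using N by auto
  have ER: "(\<Union>i\<in>{Suc N..k}. E i) = R"
  proof -
    have "(\<Union>i\<in>{Suc N..k}. E i) = (\<Union>i<Suc l. B i)"
    proof (intro equalityI subsetI)
      fix x assume "x \<in> (\<Union>i<Suc l. B i)"
      then obtain i where i: "i < Suc l" "x \<in> B i" by auto
      then have "Suc N + i \<in> {Suc N..k}" using l by auto
      moreover have "x \<in> E (Suc N + i)" using i by (simp add: E_def)
      ultimately show "x \<in> (\<Union>i\<in>{Suc N..k}. E i)" by blast
    qed (use E2 in blast)
    then show ?thesis using B(3) by simp
  qed
  show ?thesis
  proof (rule exI[of _ E], rule exI[of _ cell], rule exI[of _ "{Suc N..k}"], intro conjI ballI)
    show "{Suc N..k} \<subseteq> {1..k}" by auto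
    show "card {Suc N..k} \<le> card P" using \<open>k - N \<le> card P\<close> by simp
    show "(\<Union>i\<in>{1..k}. E i) = UNIV"
      unfolding split UN_Un ER using E1 by (auto simp: R_def)
    show "disjoint_family_on E {1..k}"
      unfolding disjoint_family_on_def
    proof (intro ballI impI)
      have AR: "A i \<inter> E j = {}" if "i \<in> {1..N}" "j \<in> {Suc N..k}" for i j
      proof -
        have "E j \<subseteq> R" using that(2) ER by blast
        then show ?thesis using that(1) unfolding R_def by blast
      qed
      fix i j assume ij: "i \<in> {1..k}" "j \<in> {1..k}" "i \<noteq> j"
      then consider "i \<in> {1..N}" "j \<in> {1..N}" | "i \<in> {1..N}" "j \<in> {Suc N..k}"
        | "i \<in> {Suc N..k}" "j \<in> {1..N}" | "i \<in> {Suc N..k}" "j \<in> {Suc N..k}"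
        unfolding split by blast
      then show "E i \<inter> E j = {}"
      proof cases
        case 1
        then show ?thesis using E1 disj ij by (simp add: disjoint_family_on_def)
      next
        case 2
        then show ?thesis using E1 AR by simp
      next
        case 3
        then show ?thesis using E1 AR by (simp add: Int_commute)
      next
        case 4
        then have "i - Suc N \<noteq> j - Suc N" using ij by auto
        then show ?thesis using E2[OF 4(1)] E2[OF 4(2)] B(2) by (auto simp: disjoint_family_on_def)
      qed
    qed
    fix i assume "i \<in> {1..k}"
    then consider "i \<in> {1..N}" | "i \<in> {Suc N..k}" unfolding split by blast
    then have "E i \<in> sets M \<and> measure M (E i) = t"
    proof cases
      case 1
      then show ?thesis using A(1,2) E1 by simp
    next
      case 2
      then show ?thesis using E2 B(1) by simp
    qed
    then show "E i \<in> sets M" "measure M (E i) = measure M UNIV / k" by (auto simp: t_def)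
  next
    fix i assume "i \<in> {1..k} - {Suc N..k}"
    then have "i \<in> {1..N}" by auto
    then show "cell i \<in> P" "E i \<subseteq> cell i" using A(3,4) E1 by auto
  qed
qed

end

section \<open>Counting tuples\<close>

lemma card_index_tuples: "card (index_tuples k m) = k choose m"
  unfolding index_tuples_def by (simp add: n_subsets)

lemma finite_index_tuples: "finite (index_tuples k m)"
  unfolding index_tuples_def by (rule finite_subset[of _ "Pow {1..k}"]) auto

text \<open>Choose an element of \<open>X\<close> in the tuple, then the other \<open>m\<close>
  indices. For bounded \<open>card X\<close> this is of lower order in \<open>k\<close> than the
  number of all tuples.\<close>

lemma card_index_tuples_meeting:
  assumes "X \<subseteq> {1..k}" "m \<le> k"
  shows "card {I \<in> index_tuples k (Suc m). I \<inter> X \<noteq> {}} \<le> card X * k ^ m"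
proof -
  have fin: "finite (X \<times> index_tuples k m)"
    using assms finite_index_tuples finite_subset[of X "{1..k}"] by auto
  have "{I \<in> index_tuples k (Suc m). I \<inter> X \<noteq> {}} \<subseteq> (\<lambda>(x, J). insert x J) ` (X \<times> index_tuples k m)"
  proof
    fix I assume "I \<in> {I \<in> index_tuples k (Suc m). I \<inter> X \<noteq> {}}"
    then obtain x where I: "I \<subseteq> {1..k}" "card I = Suc m" "x \<in> I" "x \<in> X"
      by (auto simp: index_tuples_def)
    then have "I - {x} \<in> index_tuples k m" by (auto simp: index_tuples_def)
    moreover have "I = insert x (I - {x})" using I by auto
    ultimately show "I \<in> (\<lambda>(x, J). insert x J) ` (X \<times> index_tuples k m)"
      using I(4) by (intro image_eqI[of _ _ "(x, I - {x})"]) auto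
  qed
  then have "card {I \<in> index_tuples k (Suc m). I \<inter> X \<noteq> {}} \<le> card (X \<times> index_tuples k m)"
    using fin by (rule surj_card_le[rotated])
  also have "\<dots> = card X * (k choose m)" by (simp add: card_cartesian_product card_index_tuples)
  also have "\<dots> \<le> card X * k ^ m" using binomial_le_pow[OF assms(2)] by simp
  finally show ?thesis .
qed

section \<open>Homogeneous equipartitions for a fixed measure\<close>

context hyperplane_null_measure
begin

lemma positive_fraction_homogeneous_wrt:
  "positive_fraction M (DIM('a) + 1) (homogeneous_wrt q {..<DIM('a) + 1})
    ((1 / (2 * (DIM('a) + 1))) ^ (DIM('a) + 1))"
proof unfold_locales
  show "0 < (1 / real (2 * (DIM('a) + 1))) ^ (DIM('a) + 1)" by simp
  show "(1 / real (2 * (DIM('a) + 1))) ^ (DIM('a) + 1) \<le> 1" by (intro power_le_one) auto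
  fix Y :: "nat \<Rightarrow> 'a set" assume "\<And>j. j < DIM('a) + 1 \<Longrightarrow> Y j \<in> sets M"
  then show "\<exists>Z. (\<forall>j<DIM('a) + 1. Z j \<subseteq> Y j \<and> Z j \<in> sets M \<and>
      (1 / real (2 * (DIM('a) + 1))) ^ (DIM('a) + 1) * measure M (Y j) \<le> measure M (Z j)) \<and>
      homogeneous_wrt q {..<DIM('a) + 1} Z"
    using positive_fraction_homogeneous[of "{..<DIM('a) + 1}" Y q] by (simp only: lessThan_iff Ball_def finite_lessThan card_lessThan)
qed (auto simp: space_M intro: homogeneous_wrt_mono)

text \<open>A non-homogeneous set of parts comes from a bad tuple of cells. A cell \<open>C\<close>
  holds at most \<open>measure M C / t\<close> parts, which bounds the number of sets arising from
  each bad tuple.\<close>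

lemma card_nonhomogeneous_pure:
  fixes q :: 'a and r :: nat and A cell :: "nat \<Rightarrow> 'a set"
  defines "bad P \<equiv> {u \<in> {..<r} \<rightarrow>\<^sub>E P. \<not> homogeneous_wrt q {..<r} u}"
  assumes P: "finite P" "P \<subseteq> sets M" and D: "finite D" "disjoint_family_on A D" and t: "0 < t"
    and A: "\<And>i. i \<in> D \<Longrightarrow> A i \<in> sets M \<and> measure M (A i) = t \<and> cell i \<in> P \<and> A i \<subseteq> cell i"
  shows "real (card {I. I \<subseteq> D \<and> card I = r \<and> \<not> homogeneous_wrt q I A})
    \<le> (\<Sum>u\<in>bad P. \<Prod>j<r. measure M (u j)) / t ^ r"
proof -
  define F where "F C = {i\<in>D. cell i = C}" for C
  have finF: "finite (F C)" for C using D by (simp add: F_def)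
  have cardF: "real (card (F C)) \<le> measure M C / t" if "C \<in> P" for C
  proof -
    have "disjoint_family_on A (F C)"
      using D(2) by (rule disjoint_family_on_mono[rotated]) (auto simp: F_def)
    then have "measure M (\<Union>i\<in>F C. A i) = (\<Sum>i\<in>F C. measure M (A i))"
      using finF A by (intro measure_finite_Union) (auto simp: F_def emeasure_eq_measure)
    also have "\<dots> = real (card (F C)) * t" using A by (simp add: F_def)
    finally have "real (card (F C)) * t = measure M (\<Union>i\<in>F C. A i)" by simp
    also have "\<dots> \<le> measure M C"
      using A that P by (intro finite_measure_mono) (auto simp: F_def)
    finally show ?thesis using t by (simp add: field_simps)
  qed
  have finbad: "finite (bad P)" using P by (simp add: bad_def finite_PiE)
  define V where "V = (\<Union>u\<in>bad P. PiE {..<r} (\<lambda>j. F (u j)))"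
  have "finite V" using finbad finF by (auto simp: V_def intro!: finite_PiE)
  moreover have "{I. I \<subseteq> D \<and> card I = r \<and> \<not> homogeneous_wrt q I A} \<subseteq> (\<lambda>v. v ` {..<r}) ` V"
  proof
    fix I assume "I \<in> {I. I \<subseteq> D \<and> card I = r \<and> \<not> homogeneous_wrt q I A}"
    then have I: "I \<subseteq> D" "card I = r" "\<not> homogeneous_wrt q I A" by auto
    then obtain h where h: "bij_betw h {..<r} I"
      using ex_bij_betw_nat_finite[of I] D finite_subset[of I D] by (auto simp: lessThan_atLeast0)
    have hD: "h j \<in> D" if "j < r" for j using bij_betwE[OF h] I that by auto
    define u where "u = restrict (\<lambda>j. cell (h j)) {..<r}"
    have "\<not> homogeneous_wrt q {..<r} u"
    proof
      assume "homogeneous_wrt q {..<r} u"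
      then have "homogeneous_wrt q {..<r} (\<lambda>j. A (h j))"
        by (rule homogeneous_wrt_mono) (use hD A in \<open>auto simp: u_def\<close>)
      then show False using homogeneous_wrt_reindex[OF _ h] I(3) by blast
    qed
    then have "u \<in> bad P" using hD A by (auto simp: bad_def u_def)
    moreover have "restrict h {..<r} \<in> PiE {..<r} (\<lambda>j. F (u j))"
      using hD by (auto simp: F_def u_def)
    ultimately have "restrict h {..<r} \<in> V" by (auto simp: V_def)
    moreover have "I = restrict h {..<r} ` {..<r}" using h by (simp add: bij_betw_def)
    ultimately show "I \<in> (\<lambda>v. v ` {..<r}) ` V" by blast
  qed
  ultimately have "card {I. I \<subseteq> D \<and> card I = r \<and> \<not> homogeneous_wrt q I A} \<le> card V"
    by (rule surj_card_le)
  also have "\<dots> \<le> (\<Sum>u\<in>bad P. card (PiE {..<r} (\<lambda>j. F (u j))))"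
    unfolding V_def using finbad by (rule card_UN_le)
  finally have "real (card {I. I \<subseteq> D \<and> card I = r \<and> \<not> homogeneous_wrt q I A})
      \<le> (\<Sum>u\<in>bad P. real (card (PiE {..<r} (\<lambda>j. F (u j)))))"
    by (simp flip: of_nat_sum)
  also have "\<dots> = (\<Sum>u\<in>bad P. \<Prod>j<r. real (card (F (u j))))"
    by (simp add: card_PiE)
  also have "\<dots> \<le> (\<Sum>u\<in>bad P. \<Prod>j<r. measure M (u j) / t)"
    using cardF by (intro sum_mono prod_mono) (auto simp: bad_def)
  also have "\<dots> = (\<Sum>u\<in>bad P. \<Prod>j<r. measure M (u j)) / t ^ r"
    by (simp add: prod_dividef sum_divide_distrib)
  finally show ?thesis .
qed

text \<open>The first error term counts tuples with an exceptional part, of which there are at most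
  as many as cells; the second counts the remaining non-homogeneous tuples through the
  defect.\<close>

lemma exists_homogeneous_equipartition:
  fixes q :: 'a and n k :: nat
  defines "r \<equiv> DIM('a) + 1"
  defines "c \<equiv> (1 / (2 * r)) ^ r"
  assumes pos: "0 < measure M UNIV" and k: "r \<le> k"
  shows "\<exists>A. disjoint_family_on A {1..k} \<and> (\<Union>i\<in>{1..k}. A i) = UNIV \<and>
    (\<forall>i\<in>{1..k}. A i \<in> sets M \<and> measure M (A i) = measure M UNIV / k) \<and>
    real (card {I \<in> index_tuples k r. \<not> homogeneous_wrt q I A})
      \<le> 2 ^ refinement_bound r n * real k ^ DIM('a) + (1 - c ^ r) ^ n * real k ^ r"
proof -
  interpret positive_fraction M r "homogeneous_wrt q {..<r}" c
    unfolding r_def c_def by (rule positive_fraction_homogeneous_wrt)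
  obtain G where G: "finite G" "G \<subseteq> sets M" "card G \<le> refinement_bound r n"
      "defect (atoms G) \<le> (1 - c ^ r) ^ n * measure M UNIV ^ r"
    using refine_iterate by blast
  let ?P = "atoms G"
  have P: "finite ?P" "?P \<subseteq> sets M" "\<Union>?P = UNIV"
    using finite_atoms(1)[OF G(1)] atoms_measurable[OF G(1,2) space_M] Union_atoms[of G]
    by (simp_all add: subsetI)
  have "card ?P \<le> 2 ^ card G" using finite_atoms[OF G(1)] by simp
  also have "\<dots> \<le> 2 ^ refinement_bound r n" using G(3) by (intro power_increasing) auto
  finally have cardP: "card ?P \<le> 2 ^ refinement_bound r n" .
  have "0 < k" using k by (simp add: r_def)
  obtain A cell X where A: "X \<subseteq> {1..k}" "card X \<le> card ?P"
      "disjoint_family_on A {1..k}" "(\<Union>i\<in>{1..k}. A i) = UNIV"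
      "\<forall>i\<in>{1..k}. A i \<in> sets M \<and> measure M (A i) = measure M UNIV / k"
      "\<forall>i\<in>{1..k} - X. cell i \<in> ?P \<and> A i \<subseteq> cell i"
    using exists_equipartition[OF P \<open>0 < k\<close> pos] by blast
  define t where "t = measure M UNIV / k"
  have t: "0 < t" using pos \<open>0 < k\<close> by (simp add: t_def)
  define B1 where "B1 = {I \<in> index_tuples k r. I \<inter> X \<noteq> {}}"
  define B2 where "B2 = {I. I \<subseteq> {1..k} - X \<and> card I = r \<and> \<not> homogeneous_wrt q I A}"
  have "card B1 \<le> card X * k ^ DIM('a)"
    using card_index_tuples_meeting[OF A(1), of "DIM('a)"] k by (simp add: B1_def r_def)
  also have "\<dots> \<le> 2 ^ refinement_bound r n * k ^ DIM('a)"
    using A(2) cardP by (intro mult_right_mono) auto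
  finally have "real (card B1) \<le> real (2 ^ refinement_bound r n * k ^ DIM('a))"
    by (rule of_nat_mono)
  then have B1: "real (card B1) \<le> 2 ^ refinement_bound r n * real k ^ DIM('a)" by simp
  have "real (card B2) \<le> defect ?P / t ^ r"
    unfolding B2_def defect_def weight_def bad_tuples_def
  proof (rule card_nonhomogeneous_pure[OF P(1,2) _ _ t])
    show "disjoint_family_on A ({1..k} - X)" using A(3) by (rule disjoint_family_on_mono[rotated]) auto
  qed (use A(5,6) in \<open>auto simp: t_def\<close>)
  also have "\<dots> \<le> (1 - c ^ r) ^ n * measure M UNIV ^ r / t ^ r"
    using G(4) t by (intro divide_right_mono) auto
  also have "\<dots> = (1 - c ^ r) ^ n * real k ^ r"
    using pos \<open>0 < k\<close> by (simp add: t_def power_divide)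
  finally have B2: "real (card B2) \<le> (1 - c ^ r) ^ n * real k ^ r" .
  have "{I \<in> index_tuples k r. \<not> homogeneous_wrt q I A} \<subseteq> B1 \<union> B2"
    by (auto simp: B1_def B2_def index_tuples_def)
  then have "card {I \<in> index_tuples k r. \<not> homogeneous_wrt q I A} \<le> card (B1 \<union> B2)"
    by (intro card_mono) (auto simp: B1_def B2_def finite_index_tuples)
  also have "\<dots> \<le> card B1 + card B2" by (rule card_Un_le)
  finally have "real (card {I \<in> index_tuples k r. \<not> homogeneous_wrt q I A}) \<le> real (card B1) + real (card B2)"
    by simp
  with B1 B2 A(3,4,5) show ?thesis by (intro exI[of _ A]) auto
qed

end

text \<open>A stand-in for the zero measure: its parts of equal positive measure are nonempty, as a
  partition requires.\<close>

lemma hyperplane_null_uniform_cube: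
  "hyperplane_null_measure (uniform_measure lborel (cbox 0 One :: 'a::euclidean_space set))" (is "hyperplane_null_measure ?U")
  "measure (uniform_measure lborel (cbox 0 One :: 'a::euclidean_space set)) UNIV = 1"
proof -
  have one: "emeasure lborel (cbox 0 One :: 'a set) = 1"
    by (simp add: emeasure_lborel_cbox_eq)
  interpret prob_space ?U by (rule prob_space_uniform_measure) (simp_all add: one)
  show "measure ?U UNIV = 1" using prob_space by simp
  show "hyperplane_null_measure ?U"
  proof unfold_locales
    fix a :: 'a and b :: real assume "a \<noteq> 0"
    then have "{x. a \<bullet> x = b} \<in> null_sets lebesgue"
      using negligible_hyperplane[of a b] by (simp add: negligible_iff_null_sets)
    then have "{x. a \<bullet> x = b} \<in> null_sets lborel"
      by (simp add: null_sets_completion_iff)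
    then have "cbox 0 One \<inter> {x. a \<bullet> x = b} \<in> null_sets lborel"
      by (rule null_set_Int1) simp
    then have "emeasure lborel (cbox 0 One \<inter> {x. a \<bullet> x = b}) = 0" by (rule null_setsD1)
    then show "emeasure ?U {x. a \<bullet> x = b} = 0"
      by (subst emeasure_uniform_measure) auto
  qed simp
qed

theorem theorem1p9:
  fixes \<epsilon> :: real
  assumes "\<epsilon> > 0"
  shows "\<exists>K::nat. K \<ge> CARD('n::finite) + 1 \<and>
    (\<forall>k\<ge>K. \<forall>(q :: real ^ 'n) (\<mu> :: (real ^ 'n) measure).
       sets \<mu> = sets borel \<longrightarrow> finite_measure \<mu> \<longrightarrow>
       (\<forall>a b. a \<noteq> 0 \<longrightarrow> emeasure \<mu> {x. a \<bullet> x = b} = 0) \<longrightarrow>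
       (\<exists>A :: nat \<Rightarrow> (real ^ 'n) set.
          partition_on UNIV (A ` {1..k}) \<and> inj_on A {1..k} \<and>
          (\<forall>i\<in>{1..k}. A i \<in> sets \<mu>) \<and>
          (\<forall>i\<in>{1..k}. \<forall>j\<in>{1..k}. emeasure \<mu> (A i) = emeasure \<mu> (A j)) \<and>
          real (card {I \<in> index_tuples k (CARD('n) + 1). \<not> homogeneous_wrt q I A})
            \<le> \<epsilon> * real (card (index_tuples k (CARD('n) + 1)))))"
proof -
  define r where "r = CARD('n) + 1"
  define c :: real where "c = (1 / (2 * r)) ^ r"
  \<comment> \<open>Since \<open>k choose r\<close> is at least \<open>(k / r) ^ r\<close>, two
    error terms of size \<open>\<delta> * k ^ r\<close> together stay within
    \<open>\<epsilon>\<close> times the number of tuples.\<close>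
  define \<delta> where "\<delta> = \<epsilon> / (2 * real r ^ r)"
  have r: "0 < r" by (simp add: r_def)
  then have "0 < \<delta>" using assms by (simp add: \<delta>_def)
  have "0 < c" using r by (simp add: c_def)
  then obtain n where n: "(1 - c ^ r) ^ n < \<delta>"
    using real_arch_pow_inv[OF \<open>0 < \<delta>\<close>, of "1 - c ^ r"] by auto
  \<comment> \<open>\<open>m\<close> bounds the number of cells uniformly in \<open>\<mu>\<close>
    and \<open>q\<close>; for \<open>k\<close> at least \<open>m / \<delta>\<close> the tuples with
    an exceptional part number at most \<open>\<delta> * k ^ r\<close>.\<close>
  define m where "m = (2::real) ^ refinement_bound r n"
  define K where "K = max r (nat \<lceil>m / \<delta>\<rceil>)"
  show ?thesis
  proof (intro exI[of _ K] conjI allI impI)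
    show "CARD('n) + 1 \<le> K" by (simp add: K_def r_def)
    fix k q and \<mu> :: "(real ^ 'n) measure"
    assume "K \<le> k" and sets: "sets \<mu> = sets borel" and fin: "finite_measure \<mu>"
      and null: "\<forall>a b. a \<noteq> 0 \<longrightarrow> emeasure \<mu> {x. a \<bullet> x = b} = 0"
    have k: "r \<le> k" "m / \<delta> \<le> real k"
      using \<open>K \<le> k\<close> by (auto simp: K_def nat_le_iff ceiling_le_iff)
    interpret \<mu>: hyperplane_null_measure \<mu>
      using sets fin null
      by (simp add: hyperplane_null_measure_def borel_finite_measure_def
          borel_finite_measure_axioms_def hyperplane_null_measure_axioms_def)
    \<comment> \<open>For \<open>\<mu> = 0\<close> every partition is an equipartition, so any other measure may be used.\<close>
    define \<nu> where "\<nu> = (if measure \<mu> UNIV = 0 then uniform_measure lborel (cbox 0 One) else \<mu>)"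
    have \<nu>: "hyperplane_null_measure \<nu>" "0 < measure \<nu> UNIV"
      using hyperplane_null_uniform_cube[where ?'a = "real ^ 'n"] \<mu>.hyperplane_null_measure_axioms
      by (auto simp: \<nu>_def zero_less_measure_iff)
    interpret \<nu>: hyperplane_null_measure \<nu> by (rule \<nu>(1))
    obtain A where A: "disjoint_family_on A {1..k}" "(\<Union>i\<in>{1..k}. A i) = UNIV"
        "\<forall>i\<in>{1..k}. A i \<in> sets \<nu> \<and> measure \<nu> (A i) = measure \<nu> UNIV / k"
        "real (card {I \<in> index_tuples k r. \<not> homogeneous_wrt q I A})
          \<le> m * real k ^ CARD('n) + (1 - c ^ r) ^ n * real k ^ r"
      using \<nu>.exists_homogeneous_equipartition[OF \<nu>(2), of k q n] k(1)
      by (auto simp: r_def c_def m_def)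
    \<comment> \<open>With disjointness, nonemptiness makes \<open>A\<close> injective, so that
      there are exactly \<open>k\<close> parts.\<close>
    have nonempty: "A i \<noteq> {}" if "i \<in> {1..k}" for i
      using A(3) that \<nu>(2) r k(1) by (metis divide_pos_pos measure_empty less_irrefl of_nat_0_less_iff order_less_le_trans)
    show "\<exists>A. partition_on UNIV (A ` {1..k}) \<and> inj_on A {1..k} \<and>
          (\<forall>i\<in>{1..k}. A i \<in> sets \<mu>) \<and>
          (\<forall>i\<in>{1..k}. \<forall>j\<in>{1..k}. emeasure \<mu> (A i) = emeasure \<mu> (A j)) \<and>
          real (card {I \<in> index_tuples k (CARD('n) + 1). \<not> homogeneous_wrt q I A})
            \<le> \<epsilon> * real (card (index_tuples k (CARD('n) + 1)))"
    proof (intro exI[of _ A] conjI ballI)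
      show inj: "inj_on A {1..k}"
        using A(1) nonempty by (intro inj_onI) (metis disjoint_family_onD inf.idem)
      show "partition_on UNIV (A ` {1..k})"
      proof (rule partition_onI)
        show "disjnt p p'" if pp: "p \<in> A ` {1..k}" "p' \<in> A ` {1..k}" "p \<noteq> p'" for p p'
        proof -
          obtain i j where ij: "i \<in> {1..k}" "j \<in> {1..k}" "p = A i" "p' = A j" using pp(1,2) by blast
          then have "i \<noteq> j" using pp(3) by blast
          then show ?thesis
            using disjoint_family_onD[OF A(1) ij(1,2)] unfolding disjnt_def ij(3,4) by blast
        qed
        show "\<Union>(A ` {1..k}) = UNIV" by (rule A(2))
        show "{} \<notin> A ` {1..k}" using nonempty by blast
      qed
      show meas: "A i \<in> sets \<mu>" if "i \<in> {1..k}" for i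
        using A(3) that sets \<nu>.sets_eq_borel by auto
      show "emeasure \<mu> (A i) = emeasure \<mu> (A j)" if "i \<in> {1..k}" "j \<in> {1..k}" for i j
      proof (cases "measure \<mu> UNIV = 0")
        case True
        have "measure \<mu> (A l) = 0" for l
          using \<mu>.bounded_measure[of "A l"] True by (simp add: \<mu>.space_M measure_le_0_iff)
        then show ?thesis by (simp add: \<mu>.emeasure_eq_measure)
      next
        case False
        then show ?thesis using A(3) that by (simp add: \<mu>.emeasure_eq_measure \<nu>_def)
      qed
      have "m * real k ^ CARD('n) \<le> \<delta> * real k * real k ^ CARD('n)"
        using k(2) \<open>0 < \<delta>\<close> by (intro mult_right_mono) (auto simp: field_simps)
      also have "\<dots> = \<delta> * real k ^ r" by (simp add: r_def)
      finally have "m * real k ^ CARD('n) + (1 - c ^ r) ^ n * real k ^ r \<le> \<delta> * real k ^ r + \<delta> * real k ^ r"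
        using n by (intro add_mono mult_right_mono) auto
      also have "\<dots> = \<epsilon> * (real k / real r) ^ r"
        using r by (simp add: \<delta>_def field_simps power_divide)
      also have "\<dots> \<le> \<epsilon> * real (k choose r)"
        using assms k(1) by (intro mult_left_mono binomial_ge_n_over_k_pow_k) auto
      finally show "real (card {I \<in> index_tuples k (CARD('n) + 1). \<not> homogeneous_wrt q I A})
            \<le> \<epsilon> * real (card (index_tuples k (CARD('n) + 1)))"
        using A(4) by (simp add: r_def card_index_tuples)
    qed
  qed
qed

end
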